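(* Let $n\ge 1$ and let $(\Gamma,\alpha)$ be the GKM graph of the variety $Fl(\mathbb C^{n+1})$ of complete flags in $\mathbb C^{n+1}$, with vertex set $S_{n+1}$. Let $$\mathcal A_n=\{I=[i_1,\ldots,i_n]\in\mathbb Z^n \mid 0\le i_1\le n,\ 0\le i_2\le n-1,\ \ldots,\ 0\le i_n\le 1\},$$ and for $I=[i_1,\ldots,i_n]\in\mathcal A_n$ let $C_I\colon S_{n+1}\to R(T)$ be given by $C_I(\sigma)=\sigma\cdot(z_1^{i_1}z_2^{i_2}\cdots z_n^{i_n})$. Then the set $\{C_I\mid I\in\mathcal A_n\}$ is a basis of $K_\alpha(\Gamma)$ as an $R(T)$-module, and it consists of $S_{n+1}$-invariant classes.
   Context: $T=(S^1)^{n+1}$ acts componentwise on $\mathbb C^{n+1}$ with weights $x_1,\ldots,x_{n+1}$, which form a basis of the weight lattice $\mathbb Z_T^*$. Put $z_i=e^{2\pi\sqrt{-1}x_i}$, so the representation ring of $T$ is $R(T)=\mathbb Z[z_1^{\pm1},\ldots,z_{n+1}^{\pm1}]$. The symmetric group $S_{n+1}$ acts on $R(T)$ by ring automorphisms with $\sigma\cdot z_i=z_{\sigma(i)}$. The GKM graph $(\Gamma,\alpha)$ of $Fl(\mathbb C^{n+1})$: vertices are the elements of $S_{n+1}$; $\sigma,\sigma'$ are joined by an edge iff $\sigma'=\sigma\,(i,j)$ for a transposition $(i,j)$, $1\le i<j\le n+1$; the axial function is $\alpha(\sigma,\sigma')=x_{\sigma(i)}-x_{\sigma'(i)}=x_{\sigma(i)}-x_{\sigma(j)}$.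 $K_\alpha(\Gamma)$ is the ring (and $R(T)$-module) of maps $f\colon S_{n+1}\to R(T)$ such that for every edge $(\sigma,\sigma')$, $f(\sigma)-f(\sigma')\in(1-e^{2\pi\sqrt{-1}\alpha(\sigma,\sigma')})R(T)$. A class $f\in K_\alpha(\Gamma)$ is $S_{n+1}$-invariant if $f(u)=u\cdot f(\mathrm{id})$ for every $u\in S_{n+1}$. *)

theory Defs
  imports
    "HOL-Algebra.Algebra"
    "HOL-Combinatorics.Permutations"
    "HOL-Library.Poly_Mapping"
begin

section \<open>Bases of modules\<close>

definition module_basis ::
    "('a, 'r) ring_scheme \<Rightarrow> ('a, 'b, 'm) module_scheme \<Rightarrow> 'b set \<Rightarrow> bool" where
  "module_basis R M B \<longleftrightarrow>
     B \<subseteq> carrier M \<and>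
     (\<forall>v \<in> carrier M. \<exists>F c. finite F \<and> F \<subseteq> B \<and> c \<in> F \<rightarrow> carrier R \<and>
        v = (\<Oplus>\<^bsub>M\<^esub>b\<in>F. c b \<odot>\<^bsub>M\<^esub> b)) \<and>
     (\<forall>F c. finite F \<longrightarrow> F \<subseteq> B \<longrightarrow> c \<in> F \<rightarrow> carrier R \<longrightarrow>
        (\<Oplus>\<^bsub>M\<^esub>b\<in>F. c b \<odot>\<^bsub>M\<^esub> b) = \<zero>\<^bsub>M\<^esub> \<longrightarrow> (\<forall>b\<in>F. c b = \<zero>\<^bsub>R\<^esub>))"


section \<open>The representation ring\<close>

type_synonym weight = "nat \<Rightarrow>\<^sub>0 int"
type_synonym laurent = "weight \<Rightarrow>\<^sub>0 int"

text \<open>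
  The weight lattice of the torus is the free abelian group on \<open>x\<^sub>1, \<dots>, x\<^sub>n\<^sub>+\<^sub>1\<close>, and the ring of
  Laurent polynomials \<open>\<int>[z\<^sub>1\<^sup>\<plusminus>\<^sup>1, \<dots>, z\<^sub>n\<^sub>+\<^sub>1\<^sup>\<plusminus>\<^sup>1]\<close> is its integral group ring. Both live inside types
  with infinitely many generators, of which only those with indices in \<open>{1..n+1}\<close> are admitted.
  The multiplication of \<^typ>\<open>laurent\<close> adds weights, so \<open>expw \<chi>\<close> is the Laurent monomial
  \<open>exp (2 \<pi> \<i> \<chi>)\<close>, i.e. \<open>expw (\<chi> + \<psi>) = expw \<chi> * expw \<psi>\<close>.
\<close>

abbreviation wt :: "nat \<Rightarrow> weight" where "wt i \<equiv> frag_of i"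

abbreviation expw :: "weight \<Rightarrow> laurent" where "expw \<chi> \<equiv> frag_of \<chi>"

definition zvar :: "nat \<Rightarrow> laurent" where "zvar i = expw (wt i)"

definition weight_lattice :: "nat \<Rightarrow> weight set" where
  "weight_lattice n = {\<chi>. Poly_Mapping.keys \<chi> \<subseteq> {1..n+1}}"

definition rep_ring :: "nat \<Rightarrow> laurent ring" where
  "rep_ring n = \<lparr>carrier = {p. Poly_Mapping.keys p \<subseteq> weight_lattice n},
     monoid.mult = (*), one = 1, ring.zero = 0, add = (+)\<rparr>"

text \<open>
  \<^const>\<open>frag_extend\<close> is \<open>\<int>\<close>-linear extension from the standard basis. Applied twice, it gives the
  ring endomorphism with \<open>\<sigma> \<cdot> z\<^sub>i = z\<^bsub>\<sigma>(i)\<^esub>\<close>; see \<open>act_z\<close> and \<open>act_ring_hom\<close> below.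
\<close>

definition act :: "(nat \<Rightarrow> nat) \<Rightarrow> laurent \<Rightarrow> laurent" where
  "act \<sigma> = frag_extend (expw \<circ> frag_extend (wt \<circ> \<sigma>))"


section \<open>The GKM graph of the flag variety and its K-algebra\<close>

definition vertices :: "nat \<Rightarrow> (nat \<Rightarrow> nat) set" where
  "vertices n = {\<sigma>. \<sigma> permutes {1..n+1}}"

definition edges :: "nat \<Rightarrow> ((nat \<Rightarrow> nat) \<times> (nat \<Rightarrow> nat)) set" where
  "edges n = {(\<sigma>, \<tau>). \<sigma> \<in> vertices n \<and>
     (\<exists>i j. 1 \<le> i \<and> i < j \<and> j \<le> n + 1 \<and> \<tau> = \<sigma> \<circ> transpose i j)}"

text \<open>
  If \<open>\<tau> = \<sigma> \<circ> (i j)\<close> with \<open>i < j\<close>, then \<open>i\<close> is the least index at which \<open>\<sigma>\<close> and \<open>\<tau>\<close> differ;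
  see \<open>axial_transpose\<close> below.
\<close>

definition axial :: "(nat \<Rightarrow> nat) \<Rightarrow> (nat \<Rightarrow> nat) \<Rightarrow> weight" where
  "axial \<sigma> \<tau> = (let i = LEAST i. \<sigma> i \<noteq> \<tau> i in wt (\<sigma> i) - wt (\<tau> i))"

text \<open>The carrier consists of extensional functions, so equality is equality on vertices.\<close>

definition K_alg :: "nat \<Rightarrow> (laurent, (nat \<Rightarrow> nat) \<Rightarrow> laurent) module" where
  "K_alg n = \<lparr>carrier = {f \<in> vertices n \<rightarrow>\<^sub>E carrier (rep_ring n).
        \<forall>(\<sigma>, \<tau>) \<in> edges n. f \<sigma> - f \<tau> \<in> PIdl\<^bsub>rep_ring n\<^esub> (1 - expw (axial \<sigma> \<tau>))},
     monoid.mult = (\<lambda>f g. \<lambda>\<sigma>\<in>vertices n. f \<sigma> * g \<sigma>),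
     one = (\<lambda>\<sigma>\<in>vertices n. 1),
     ring.zero = (\<lambda>\<sigma>\<in>vertices n. 0),
     add = (\<lambda>f g. \<lambda>\<sigma>\<in>vertices n. f \<sigma> + g \<sigma>),
     smult = (\<lambda>r f. \<lambda>\<sigma>\<in>vertices n. r * f \<sigma>)\<rparr>"

definition invariant_class :: "nat \<Rightarrow> ((nat \<Rightarrow> nat) \<Rightarrow> laurent) \<Rightarrow> bool" where
  "invariant_class n f \<longleftrightarrow>
     f \<in> carrier (K_alg n) \<and> (\<forall>u \<in> vertices n. f u = act u (f id))"


section \<open>The classes \<open>C\<^sub>I\<close>\<close>

text \<open>
  A list \<open>I\<close> of length \<open>n\<close> stands for \<open>[i\<^sub>1, \<dots>, i\<^sub>n]\<close>, with \<open>i\<^sub>k = I ! (k - 1)\<close>.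
  The bound on \<open>i\<^sub>k\<close> is \<open>n + 1 - k\<close>. The entries are nonnegative, so \<^const>\<open>nat\<close> loses nothing
  in the exponents.
\<close>

definition index_set :: "nat \<Rightarrow> int list set" where
  "index_set n = {I. length I = n \<and>
     (\<forall>k \<in> {1..n}. 0 \<le> I ! (k - 1) \<and> I ! (k - 1) \<le> int n + 1 - int k)}"

definition C_class :: "nat \<Rightarrow> int list \<Rightarrow> (nat \<Rightarrow> nat) \<Rightarrow> laurent" where
  "C_class n I = (\<lambda>\<sigma>\<in>vertices n. act \<sigma> (\<Prod>k=1..n. zvar k ^ nat (I ! (k - 1))))"


section \<open>Well-formedness of the definitions\<close>

lemma expw_add: "expw (\<chi> + \<psi>) = expw \<chi> * expw \<psi>"
  by (simp add: mult_single)

lemma act_expw: "act \<sigma> (expw \<chi>) = expw (frag_extend (wt \<circ> \<sigma>) \<chi>)"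
  by (simp add: act_def frag_extend_of)

lemma act_z: "act \<sigma> (zvar i) = zvar (\<sigma> i)"
  by (simp add: act_expw zvar_def)

lemma act_one: "act \<sigma> 1 = 1"
  using act_expw [of \<sigma> 0] by simp

lemma act_add: "act \<sigma> (p + q) = act \<sigma> p + act \<sigma> q"
  by (simp add: act_def frag_extend_add)

lemma act_diff: "act \<sigma> (p - q) = act \<sigma> p - act \<sigma> q"
  by (simp add: act_def frag_extend_diff)

lemma act_mult: "act \<sigma> (p * q) = act \<sigma> p * act \<sigma> q"
proof (induction p rule: frag_induction [OF subset_UNIV])
  case 1
  then show ?case by (simp add: act_def)
next
  case (2 \<chi>)
  show ?case
  proof (induction q rule: frag_induction [OF subset_UNIV])
    case 1
    then show ?case by (simp add: act_def)
  next
    case (2 \<psi>)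
    then show ?case
      by (simp add: act_expw frag_extend_add flip: expw_add)
  next
    case (3 a b)
    then show ?case
      by (simp add: act_diff algebra_simps)
  qed
next
  case (3 a b)
  then show ?case
    by (simp add: act_diff algebra_simps)
qed

lemma cring_rep_ring: "cring (rep_ring n)"
proof (rule cringI)
  show "abelian_group (rep_ring n)"
  proof (rule abelian_groupI)
    fix p q assume "p \<in> carrier (rep_ring n)" "q \<in> carrier (rep_ring n)"
    then show "p \<oplus>\<^bsub>rep_ring n\<^esub> q \<in> carrier (rep_ring n)"
      using keys_add [of p q] by (auto simp: rep_ring_def)
  next
    fix p assume "p \<in> carrier (rep_ring n)"
    then show "\<exists>q\<in>carrier (rep_ring n). q \<oplus>\<^bsub>rep_ring n\<^esub> p = \<zero>\<^bsub>rep_ring n\<^esub>"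
      by (intro bexI [of _ "- p"]) (auto simp: rep_ring_def)
  qed (auto simp: rep_ring_def algebra_simps)
  have "p * q \<in> carrier (rep_ring n)"
    if "p \<in> carrier (rep_ring n)" "q \<in> carrier (rep_ring n)" for p q
  proof -
    have "\<chi> + \<psi> \<in> weight_lattice n"
      if "\<chi> \<in> weight_lattice n" "\<psi> \<in> weight_lattice n" for \<chi> \<psi>
      using that keys_add [of \<chi> \<psi>] by (auto simp: weight_lattice_def)
    then show ?thesis
      using that keys_mult [of p q] by (fastforce simp: rep_ring_def)
  qed
  moreover have "1 \<in> carrier (rep_ring n)"
    by (auto simp: rep_ring_def weight_lattice_def)
  ultimately show "comm_monoid (rep_ring n)"
    by (intro comm_monoidI) (auto simp: rep_ring_def algebra_simps)
qed (auto simp: rep_ring_def algebra_simps)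

lemma rep_ring_simps [simp]:
  "p \<otimes>\<^bsub>rep_ring n\<^esub> q = p * q" "p \<oplus>\<^bsub>rep_ring n\<^esub> q = p + q"
  "\<one>\<^bsub>rep_ring n\<^esub> = 1" "\<zero>\<^bsub>rep_ring n\<^esub> = 0"
  by (simp_all add: rep_ring_def)

lemma act_carrier:
  assumes "\<sigma> \<in> vertices n" "p \<in> carrier (rep_ring n)"
  shows "act \<sigma> p \<in> carrier (rep_ring n)"
proof -
  have "frag_extend (wt \<circ> \<sigma>) \<chi> \<in> weight_lattice n" if "\<chi> \<in> weight_lattice n" for \<chi>
  proof -
    have "\<sigma> i \<in> {1..n+1}" if "i \<in> Poly_Mapping.keys \<chi>" for i
      using that \<open>\<chi> \<in> _\<close> assms(1) permutes_in_image [of \<sigma> "{1..n+1}" i]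
      by (auto simp: weight_lattice_def vertices_def)
    then have "(\<Union>i\<in>Poly_Mapping.keys \<chi>. Poly_Mapping.keys ((wt \<circ> \<sigma>) i)) \<subseteq> {1..n+1}"
      by auto
    then show ?thesis
      using keys_frag_extend [of "wt \<circ> \<sigma>" \<chi>] by (auto simp only: weight_lattice_def)
  qed
  then show ?thesis
    using assms(2) keys_frag_extend [of "expw \<circ> frag_extend (wt \<circ> \<sigma>)" p]
    by (auto simp: rep_ring_def act_def subset_iff)
qed

lemma act_ring_hom: "\<sigma> \<in> vertices n \<Longrightarrow> act \<sigma> \<in> ring_hom (rep_ring n) (rep_ring n)"
  by (auto simp: ring_hom_def act_carrier act_mult act_add act_one)

lemma axial_transpose:
  assumes "\<sigma> \<in> vertices n" "i < j"
  shows "axial \<sigma> (\<sigma> \<circ> transpose i j) = wt (\<sigma> i) - wt (\<sigma> j)"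
proof -
  have "inj \<sigma>"
    using assms(1) by (auto simp: vertices_def permutes_inj)
  then have "\<sigma> k \<noteq> (\<sigma> \<circ> transpose i j) k \<longleftrightarrow> k = i \<or> k = j" for k
    using assms(2) by (auto simp: transpose_def inj_eq)
  then have "(LEAST k. \<sigma> k \<noteq> (\<sigma> \<circ> transpose i j) k) = i"
    using assms(2) by (simp only:) (auto intro: Least_equality)
  then show ?thesis
    by (simp add: axial_def)
qed

lemma algebra_K_alg: "algebra (rep_ring n) (K_alg n)"
proof -
  interpret R: cring "rep_ring n"
    by (rule cring_rep_ring)
  define J where "J = (\<lambda>\<sigma> \<tau>. PIdl\<^bsub>rep_ring n\<^esub> (1 - expw (axial \<sigma> \<tau>)))"
  have J_iff: "p \<in> J \<sigma> \<tau> \<longleftrightarrow> (\<exists>r \<in> carrier (rep_ring n). p = r * (1 - expw (axial \<sigma> \<tau>)))"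
    for p \<sigma> \<tau>
    by (auto simp: J_def cgenideal_def)
  have J_add: "p + q \<in> J \<sigma> \<tau>" if p: "p \<in> J \<sigma> \<tau>" and q: "q \<in> J \<sigma> \<tau>" for p q \<sigma> \<tau>
  proof -
    obtain r s where "r \<in> carrier (rep_ring n)" "s \<in> carrier (rep_ring n)"
      "p = r * (1 - expw (axial \<sigma> \<tau>))" "q = s * (1 - expw (axial \<sigma> \<tau>))"
      using p q by (auto simp: J_iff)
    then show ?thesis
      using R.a_closed [of r s] unfolding J_iff
      by (intro bexI [of _ "r + s"]) (simp_all add: distrib_right)
  qed
  have J_mult: "r * p \<in> J \<sigma> \<tau>" if r: "r \<in> carrier (rep_ring n)" and p: "p \<in> J \<sigma> \<tau>"
    for r p \<sigma> \<tau>
  proof -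
    obtain s where "s \<in> carrier (rep_ring n)" "p = s * (1 - expw (axial \<sigma> \<tau>))"
      using p by (auto simp: J_iff)
    then show ?thesis
      using R.m_closed [of r s] r unfolding J_iff
      by (intro bexI [of _ "r * s"]) (simp_all only: mult.assoc rep_ring_simps)
  qed
  have J_zero: "0 \<in> J \<sigma> \<tau>" for \<sigma> \<tau>
    using R.zero_closed unfolding J_iff by (intro bexI [of _ 0]) simp_all
  have neg: "- p \<in> carrier (rep_ring n)" if "p \<in> carrier (rep_ring n)" for p
    using that by (simp add: rep_ring_def)
  have edgeD: "\<sigma> \<in> vertices n \<and> \<tau> \<in> vertices n" if "(\<sigma>, \<tau>) \<in> edges n" for \<sigma> \<tau>
    using that by (auto simp: edges_def vertices_def intro!: permutes_compose permutes_swap_id)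
  have K_iff: "f \<in> carrier (K_alg n) \<longleftrightarrow>
      f \<in> extensional (vertices n) \<and> (\<forall>\<sigma>\<in>vertices n. f \<sigma> \<in> carrier (rep_ring n)) \<and>
      (\<forall>\<sigma> \<tau>. (\<sigma>, \<tau>) \<in> edges n \<longrightarrow> f \<sigma> - f \<tau> \<in> J \<sigma> \<tau>)" for f
    by (auto simp: K_alg_def J_def PiE_def)
  have Rc: "p + q \<in> carrier (rep_ring n)" "p * q \<in> carrier (rep_ring n)"
    if "p \<in> carrier (rep_ring n)" "q \<in> carrier (rep_ring n)" for p q
    using R.a_closed [OF that] R.m_closed [OF that] by simp_all
  have R01: "0 \<in> carrier (rep_ring n)" "1 \<in> carrier (rep_ring n)"
    using R.zero_closed R.one_closed by simp_all
  have ops: "f \<otimes>\<^bsub>K_alg n\<^esub> g = (\<lambda>\<sigma>\<in>vertices n. f \<sigma> * g \<sigma>)"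
    "f \<oplus>\<^bsub>K_alg n\<^esub> g = (\<lambda>\<sigma>\<in>vertices n. f \<sigma> + g \<sigma>)"
    "r \<odot>\<^bsub>K_alg n\<^esub> g = (\<lambda>\<sigma>\<in>vertices n. r * g \<sigma>)"
    "\<one>\<^bsub>K_alg n\<^esub> = (\<lambda>\<sigma>\<in>vertices n. 1)" "\<zero>\<^bsub>K_alg n\<^esub> = (\<lambda>\<sigma>\<in>vertices n. 0)" for f g r
    by (simp_all add: K_alg_def)
  have ext: "f = g" if "f \<in> extensional (vertices n)" "g \<in> extensional (vertices n)"
    "\<And>\<sigma>. \<sigma> \<in> vertices n \<Longrightarrow> f \<sigma> = g \<sigma>" for f g :: "(nat \<Rightarrow> nat) \<Rightarrow> laurent"
    using that by (rule extensionalityI)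
  have smult_closed: "r \<odot>\<^bsub>K_alg n\<^esub> f \<in> carrier (K_alg n)"
    if "r \<in> carrier (rep_ring n)" "f \<in> carrier (K_alg n)" for r f
  proof -
    have "r * f \<sigma> - r * f \<tau> \<in> J \<sigma> \<tau>" if "(\<sigma>, \<tau>) \<in> edges n" for \<sigma> \<tau>
      using that \<open>r \<in> _\<close> \<open>f \<in> _\<close> J_mult [of r "f \<sigma> - f \<tau>"]
      by (simp add: K_iff right_diff_distrib)
    then show ?thesis
      using that edgeD by (auto simp: K_iff ops Rc)
  qed
  have add_closed: "f \<oplus>\<^bsub>K_alg n\<^esub> g \<in> carrier (K_alg n)"
    if "f \<in> carrier (K_alg n)" "g \<in> carrier (K_alg n)" for f g
  proof -
    have "f \<sigma> + g \<sigma> - (f \<tau> + g \<tau>) \<in> J \<sigma> \<tau>" if "(\<sigma>, \<tau>) \<in> edges n" for \<sigma> \<tau>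
    proof -
      have "(f \<sigma> - f \<tau>) + (g \<sigma> - g \<tau>) \<in> J \<sigma> \<tau>"
        using that \<open>f \<in> _\<close> \<open>g \<in> _\<close> by (intro J_add) (auto simp: K_iff)
      then show ?thesis by (simp add: algebra_simps)
    qed
    then show ?thesis
      using that edgeD by (auto simp: K_iff ops Rc)
  qed
  have mult_closed: "f \<otimes>\<^bsub>K_alg n\<^esub> g \<in> carrier (K_alg n)"
    if "f \<in> carrier (K_alg n)" "g \<in> carrier (K_alg n)" for f g
  proof -
    have "f \<sigma> * g \<sigma> - f \<tau> * g \<tau> \<in> J \<sigma> \<tau>" if "(\<sigma>, \<tau>) \<in> edges n" for \<sigma> \<tau>
    proof -
      have "f \<sigma> * (g \<sigma> - g \<tau>) + g \<tau> * (f \<sigma> - f \<tau>) \<in> J \<sigma> \<tau>"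
        using that \<open>f \<in> _\<close> \<open>g \<in> _\<close> edgeD [OF that]
        by (intro J_add J_mult) (auto simp: K_iff)
      then show ?thesis by (simp add: algebra_simps)
    qed
    then show ?thesis
      using that edgeD by (auto simp: K_iff ops Rc)
  qed
  have zero_closed: "\<zero>\<^bsub>K_alg n\<^esub> \<in> carrier (K_alg n)"
    and one_closed: "\<one>\<^bsub>K_alg n\<^esub> \<in> carrier (K_alg n)"
    using edgeD by (auto simp: K_iff ops R01 J_zero)
  have minus: "\<exists>g\<in>carrier (K_alg n). g \<oplus>\<^bsub>K_alg n\<^esub> f = \<zero>\<^bsub>K_alg n\<^esub>"
    if "f \<in> carrier (K_alg n)" for f
  proof
    show "(-1) \<odot>\<^bsub>K_alg n\<^esub> f \<in> carrier (K_alg n)"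
      using that by (intro smult_closed neg R01)
    show "(-1) \<odot>\<^bsub>K_alg n\<^esub> f \<oplus>\<^bsub>K_alg n\<^esub> f = \<zero>\<^bsub>K_alg n\<^esub>"
      by (auto simp: ops)
  qed
  have "abelian_group (K_alg n)"
    using add_closed zero_closed minus
    by (intro abelian_groupI)
      (auto simp: K_iff ops extensional_def algebra_simps)
  moreover have "comm_monoid (K_alg n)"
    using mult_closed one_closed
    by (intro comm_monoidI)
      (auto simp: K_iff ops extensional_def algebra_simps)
  ultimately have "cring (K_alg n)"
    by (intro cringI) (auto simp: ops algebra_simps)
  then show ?thesis
    using cring_rep_ring smult_closed
    by (intro algebraI)
      (auto simp: K_iff ops extensional_def algebra_simps)
qed

end

theory Submission
  imports Defs "HOL-Combinatorics.Multiset_Permutations" "HOL-Computational_Algebra.Polynomial"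
begin

text \<open>
  Reading a permutation as the list of its values, the GKM conditions say that exchanging the values
  \<open>a\<close> and \<open>b\<close> changes the class by a multiple of \<open>z\<^sub>a - z\<^sub>b\<close>. These differences are pairwise
  non-associated primes, since the kernel of the substitution \<open>z\<^sub>b \<mapsto> z\<^sub>a\<close> on the integral domain of
  Laurent polynomials is generated by \<open>z\<^sub>a - z\<^sub>b\<close>. Expand by induction along the flag: for a fixed
  first value \<open>a\<close>, the class is a combination of the monomials in the remaining values. A Vandermonde
  argument shows that these monomials are independent modulo \<open>z\<^sub>a - z\<^sub>b\<close>, so the coefficients for \<open>a\<close>
  and \<open>b\<close> are congruent modulo \<open>z\<^sub>a - z\<^sub>b\<close>, and Newton interpolation writes them as polynomials
  in \<open>z\<^sub>a\<close> of the required degree.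
\<close>

section \<open>Evaluation and interpolation modulo primes\<close>

lemma const_poly_dvd_if_dvd_values:
  fixes d :: "'a::idom" and z :: "'b \<Rightarrow> 'a"
  assumes prime: "\<And>x y. d dvd x * y \<Longrightarrow> d dvd x \<or> d dvd y"
    and "finite A"
    and "\<And>a b. a \<in> A \<Longrightarrow> b \<in> A \<Longrightarrow> d dvd z a - z b \<Longrightarrow> a = b"
    and "Polynomial.degree p < card A"
    and "\<And>a. a \<in> A \<Longrightarrow> d dvd poly p (z a)"
  shows "[:d:] dvd p"
  using assms(2-)
proof (induction A arbitrary: p rule: finite_induct)
  case (insert a A)
  define q where "q = synthetic_div p (z a)"
  have p: "p = [:- z a, 1:] * q + [:poly p (z a):]"
    by (simp only: q_def synthetic_div_correct')
  have const: "[:d:] dvd [:poly p (z a):]"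
    using insert.prems(3) [of a] by (auto simp: const_poly_dvd_iff coeff_pCons split: nat.splits)
  have "[:d:] dvd q"
  \<comment> \<open>With a single node \<open>q\<close> vanishes, while the bound
    \<open>degree q < card A\<close> required by the induction hypothesis fails for empty
    \<open>A\<close>.\<close>
  proof (cases "A = {}")
    case True
    then show ?thesis
      using insert.prems(2) by (simp add: q_def synthetic_div_eq_0_iff [THEN iffD2])
  next
    case False
    then have "card A > 0"
      using insert.hyps(1) by (simp add: card_gt_0_iff)
    show ?thesis
    proof (rule insert.IH)
      show "Polynomial.degree q < card A"
        using insert.prems(2) insert.hyps \<open>card A > 0\<close>
        by (simp add: q_def degree_synthetic_div)
    next
      fix b assume "b \<in> A"
      have "poly p (z b) - poly p (z a) = (z b - z a) * poly q (z b)"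
        by (subst p) (simp add: algebra_simps)
      moreover have "d dvd poly p (z b) - poly p (z a)"
        using \<open>b \<in> A\<close> insert.prems(3) by (intro dvd_diff) auto
      moreover have "\<not> d dvd z b - z a"
        using insert.prems(1) [of b a] \<open>b \<in> A\<close> insert.hyps(2) by auto
      ultimately show "d dvd poly q (z b)"
        using prime by metis
    qed (use insert.prems(1) in auto)
  qed
  then show ?case
    by (subst p) (intro dvd_add dvd_mult const)
qed simp

lemma poly_eq_sum_atMost:
  fixes p :: "'a::comm_semiring_1 poly"
  assumes "Polynomial.degree p \<le> m"
  shows "poly p x = (\<Sum>i\<le>m. Polynomial.coeff p i * x ^ i)"
  unfolding poly_altdef using assms
  by (intro sum.mono_neutral_left) (auto simp: coeff_eq_0)

text \<open>Injectivity of a Vandermonde system modulo \<open>d\<close>: a polynomial of degree at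
  most \<open>m\<close> that vanishes modulo \<open>d\<close> at \<open>m + 1\<close> incongruent
  nodes is zero modulo \<open>d\<close>.\<close>

lemma dvd_coeffs_if_dvd_values:
  fixes d :: "'a::idom" and z :: "'b \<Rightarrow> 'a"
  assumes "\<And>x y. d dvd x * y \<Longrightarrow> d dvd x \<or> d dvd y"
    and "card A = Suc m"
    and "\<And>a b. a \<in> A \<Longrightarrow> b \<in> A \<Longrightarrow> d dvd z a - z b \<Longrightarrow> a = b"
    and vals: "\<And>a. a \<in> A \<Longrightarrow> d dvd (\<Sum>i\<le>m. h i * z a ^ i)"
    and "i \<le> m"
  shows "d dvd h i"
proof -
  define p where "p = (\<Sum>i\<le>m. Polynomial.monom (h i) i)"
  have "finite A"
    using assms(2) by (simp add: card_ge_0_finite)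
  have "Polynomial.degree p < card A"
    unfolding p_def assms(2) less_Suc_eq_le
    by (intro degree_sum_le) (auto intro: order_trans [OF degree_monom_le])
  then have "[:d:] dvd p"
    using assms(1,3) vals \<open>finite A\<close>
    by (intro const_poly_dvd_if_dvd_values [where z = z and A = A])
      (auto simp: p_def poly_sum poly_monom)
  moreover have "Polynomial.coeff p i = h i"
    using \<open>i \<le> m\<close> by (simp add: p_def Polynomial.coeff_sum)
  ultimately show ?thesis
    by (metis const_poly_dvd_iff)
qed

text \<open>The span argument uses nothing about Laurent polynomials beyond these facts: differences
  satisfy the divisibility form of primality, and differences of distinct pairs are not
  associated.\<close>

locale prime_differences =
  fixes z :: "'b \<Rightarrow> 'a::idom"
  assumes prime: "a \<noteq> b \<Longrightarrow> z a - z b dvd x * y \<Longrightarrow> z a - z b dvd x \<or> z a - z b dvd y"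
    and dvd_difference: "a \<noteq> b \<Longrightarrow> z a - z b dvd z c - z e \<Longrightarrow> c = e \<or> {c, e} = {a, b}"
begin

text \<open>Newton interpolation: the divided differences again satisfy the congruences, because
  distinct differences are non-associated primes.\<close>

lemma interpolation:
  assumes "finite A" "A \<noteq> {}"
    and "\<And>a b. a \<in> A \<Longrightarrow> b \<in> A \<Longrightarrow> z a - z b dvd g a - g b"
  shows "\<exists>p. Polynomial.degree p < card A \<and> (\<forall>a\<in>A. poly p (z a) = g a)"
  using assms
proof (induction A arbitrary: g rule: finite_ne_induct)
  case (singleton a)
  then show ?case
    by (intro exI [of _ "[:g a:]"]) simp
next
  case (insert b A)
  have "\<forall>a\<in>A. \<exists>k. g a = g b + (z a - z b) * k"
    using insert.prems [of _ b] by (fastforce simp: dvd_def algebra_simps)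
  then obtain k where k: "\<And>a. a \<in> A \<Longrightarrow> g a = g b + (z a - z b) * k a"
    by metis
  have "\<exists>p. Polynomial.degree p < card A \<and> (\<forall>a\<in>A. poly p (z a) = k a)"
  proof (rule insert.IH)
    fix a c assume ac: "a \<in> A" "c \<in> A"
    show "z a - z c dvd k a - k c"
    proof (cases "a = c")
      case False
      have "g a - g c = (z a - z b) * (k a - k c) + (z a - z c) * k c"
        using ac by (simp add: k algebra_simps)
      then have "z a - z c dvd (z a - z b) * (k a - k c)"
        using insert.prems [of a c] ac by (metis dvd_add_left_iff dvd_triv_left insertI2)
      moreover have "\<not> z a - z c dvd z a - z b"
        using dvd_difference [OF False, of a b] insert.hyps ac by (auto simp: doubleton_eq_iff)
      ultimately show ?thesis
        using prime [OF False] by blast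
    qed simp
  qed
  then obtain p where p: "Polynomial.degree p < card A" "\<And>a. a \<in> A \<Longrightarrow> poly p (z a) = k a"
    by blast
  have "Polynomial.degree ([:- z b, 1:] * p) \<le> Suc (Polynomial.degree p)"
    using degree_mult_le [of "[:- z b, 1:]" p] by simp
  then have "Polynomial.degree ([:g b:] + [:- z b, 1:] * p) < card (insert b A)"
    using p(1) insert.hyps by (intro degree_add_less) auto
  moreover have "poly ([:g b:] + [:- z b, 1:] * p) (z a) = g a" if "a \<in> insert b A" for a
    using that p(2) k by (auto simp: algebra_simps)
  ultimately show ?case
    by blast
qed

end

section \<open>Staircase monomials along a flag\<close>

text \<open>\<open>map2\<close> stops at the shorter list: an index has one entry fewer than a flag,
  so the last flag entry gets no exponent.\<close>

definition flag_monomial :: "('b \<Rightarrow> 'a::comm_ring_1) \<Rightarrow> int list \<Rightarrow> 'b list \<Rightarrow> 'a" where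
  "flag_monomial z I xs = prod_list (map2 (\<lambda>i x. z x ^ nat i) I xs)"

lemma flag_monomial_Nil [simp]: "flag_monomial z [] xs = 1"
  by (simp add: flag_monomial_def)

lemma flag_monomial_Cons [simp]:
  "flag_monomial z (i # I) (x # xs) = z x ^ nat i * flag_monomial z I xs"
  by (simp add: flag_monomial_def)

text \<open>Exchanging \<open>a\<close> and \<open>b\<close> fixes every variable modulo
  \<open>z a - z b\<close>, and telescoping over the factors carries this to products. These become
  the GKM congruences of the classes \<open>C_class n I\<close>.\<close>

lemma flag_monomial_map_transpose:
  "z a - z b dvd flag_monomial z I xs - flag_monomial z I (map (transpose a b) xs)"
proof (induction I arbitrary: xs)
  case (Cons i I)
  show ?case
  proof (cases xs)
    case (Cons x ys)
    let ?y = "transpose a b x"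
    have "z a - z b dvd z x - z ?y"
    proof -
      have "z x - z ?y \<in> {0, z a - z b, - (z a - z b)}"
        by (auto simp: transpose_def)
      then show ?thesis
        by (metis dvd_0_right dvd_minus_iff dvd_refl empty_iff insert_iff)
    qed
    then have "z a - z b dvd z x ^ nat i - z ?y ^ nat i"
      unfolding power_diff_sumr2 by (rule dvd_mult2)
    then have "z a - z b dvd (z x ^ nat i - z ?y ^ nat i) * flag_monomial z I ys
        + z ?y ^ nat i * (flag_monomial z I ys - flag_monomial z I (map (transpose a b) ys))"
      using Cons.IH by (intro dvd_add dvd_mult dvd_mult2)
    then show ?thesis
      by (simp add: \<open>xs = _\<close> algebra_simps)
  qed (simp add: flag_monomial_def)
qed simp

section \<open>Recursive structure of the staircase index set\<close>

lemma index_set_0: "index_set 0 = {[]}"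
  by (auto simp: index_set_def)

text \<open>Dropping the first entry shifts positions and bounds together, so the staircase recurs;
  this matches removing the first entry of a flag.\<close>

lemma Cons_in_index_set_iff:
  "i # I \<in> index_set (Suc n) \<longleftrightarrow> 0 \<le> i \<and> i \<le> int (Suc n) \<and> I \<in> index_set n"
proof -
  \<comment> \<open>Positions are counted from zero here, so the bound at \<open>k\<close> is
    \<open>n - k\<close> instead of \<open>n + 1 - k\<close>.\<close>
  have iff: "I \<in> index_set n \<longleftrightarrow> length I = n \<and> (\<forall>k<n. 0 \<le> I ! k \<and> I ! k \<le> int n - int k)"
    for I n
  proof -
    have "{1..n} = Suc ` {..<n}"
      by (simp add: image_Suc_lessThan)
    then show ?thesis
      unfolding index_set_def by auto
  qed
  show ?thesis
    unfolding iff by (auto simp: All_less_Suc2)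
qed

lemma index_set_SucE:
  assumes "I \<in> index_set (Suc n)"
  obtains i J where "I = int i # J" "i \<le> Suc n" "J \<in> index_set n"
proof -
  obtain i J where I: "I = i # J"
    using assms by (cases I) (auto simp: index_set_def)
  then show thesis
    using assms that [of "nat i" J] by (auto simp: Cons_in_index_set_iff)
qed

lemma bij_betw_index_set_Suc:
  "bij_betw (\<lambda>(i, I). int i # I) ({..Suc n} \<times> index_set n) (index_set (Suc n))"
  by (rule bij_betw_imageI)
    (auto simp: inj_on_def Cons_in_index_set_iff image_iff elim!: index_set_SucE)

lemma finite_index_set: "finite (index_set n)"
proof (induction n)
  case (Suc n)
  then show ?case
    using bij_betw_finite [OF bij_betw_index_set_Suc [of n]] by simp
qed (simp add: index_set_0)

text \<open>Regrouping by the first variable: the tail monomials receive as coefficients polynomials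
  in \<open>z x\<close> of degree at most \<open>n + 1\<close>. Both inductions below rest on this
  form.\<close>

lemma sum_index_set_Suc:
  "(\<Sum>I\<in>index_set (Suc n). c I * flag_monomial z I (x # xs)) =
    (\<Sum>I\<in>index_set n. (\<Sum>i\<le>Suc n. c (int i # I) * z x ^ i) * flag_monomial z I xs)"
proof -
  have "(\<Sum>I\<in>index_set (Suc n). c I * flag_monomial z I (x # xs)) =
      (\<Sum>(i, I)\<in>{..Suc n} \<times> index_set n. c (int i # I) * z x ^ i * flag_monomial z I xs)"
    by (subst sum.reindex_bij_betw [OF bij_betw_index_set_Suc, symmetric])
      (auto intro!: sum.cong simp: mult.assoc)
  also have "\<dots> = (\<Sum>I\<in>index_set n. \<Sum>i\<le>Suc n. c (int i # I) * z x ^ i * flag_monomial z I xs)"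
    by (subst sum.swap) (simp only: sum.cartesian_product)
  finally show ?thesis
    by (simp only: sum_distrib_right)
qed

lemma permutations_of_set_Cons_iff:
  "x # xs \<in> permutations_of_set A \<longleftrightarrow> x \<in> A \<and> xs \<in> permutations_of_set (A - {x})"
  by (auto simp: permutations_of_set_def)

text \<open>For a fixed first entry \<open>a\<close>, induction over \<open>A - {a}\<close> makes
  each tail coefficient, a polynomial in \<open>z a\<close>, vanish modulo \<open>d\<close>; letting
  \<open>a\<close> vary gives a Vandermonde system. Used with \<open>d\<close> a difference of
  variables and with \<open>d = 0\<close>.\<close>

lemma flag_monomials_independent_mod:
  fixes d :: "'a::idom" and z :: "'b \<Rightarrow> 'a"
  assumes prime: "\<And>x y. d dvd x * y \<Longrightarrow> d dvd x \<or> d dvd y"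
    and "card A = Suc n"
    and "\<And>a b. a \<in> A \<Longrightarrow> b \<in> A \<Longrightarrow> d dvd z a - z b \<Longrightarrow> a = b"
    and "\<And>xs. xs \<in> permutations_of_set A \<Longrightarrow> d dvd (\<Sum>I\<in>index_set n. h I * flag_monomial z I xs)"
    and "I \<in> index_set n"
  shows "d dvd h I"
  using assms(2-)
proof (induction n arbitrary: A h I)
  case 0
  then obtain xs where "xs \<in> permutations_of_set A"
    by (metis card_1_singleton_iff One_nat_def permutations_of_set_singleton singletonI)
  then show ?case
    using 0 by (fastforce simp: index_set_0)
next
  case (Suc n)
  obtain i J where I: "I = int i # J" "i \<le> Suc n" "J \<in> index_set n"
    using Suc.prems(4) by (rule index_set_SucE)
  show ?case
    unfolding I(1)
  \<comment> \<open>\<open>A\<close> has \<open>n + 2\<close> elements, one more than the degree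
    bound \<open>n + 1\<close> in the first variable.\<close>
  proof (rule dvd_coeffs_if_dvd_values [OF prime Suc.prems(1,2) _ I(2)])
    fix a assume "a \<in> A"
    show "d dvd (\<Sum>i\<le>Suc n. h (int i # J) * z a ^ i)"
    proof (rule Suc.IH [of "A - {a}"])
      show "d dvd (\<Sum>I\<in>index_set n. (\<Sum>i\<le>Suc n. h (int i # I) * z a ^ i) * flag_monomial z I xs)"
        if "xs \<in> permutations_of_set (A - {a})" for xs
        using Suc.prems(3) [of "a # xs"] that \<open>a \<in> A\<close>
        by (simp only: permutations_of_set_Cons_iff sum_index_set_Suc)
    qed (use Suc.prems(1,2) \<open>a \<in> A\<close> I(3) in auto)
  qed
qed

text \<open>The congruences pass from \<open>F\<close> to the coefficients of the tail expansions,
  as interpolation over the possible first entries requires. The resulting degree bound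
  \<open>card A - 1\<close> is exactly the staircase bound on the first exponent.\<close>

lemma (in prime_differences) flag_monomials_span:
  assumes "card A = Suc n"
    and "\<And>xs a b. xs \<in> permutations_of_set A \<Longrightarrow> a \<in> A \<Longrightarrow> b \<in> A \<Longrightarrow>
      z a - z b dvd F xs - F (map (transpose a b) xs)"
  shows "\<exists>c. \<forall>xs\<in>permutations_of_set A. F xs = (\<Sum>I\<in>index_set n. c I * flag_monomial z I xs)"
  using assms
proof (induction n arbitrary: A F)
  case 0
  then obtain a where "A = {a}"
    by (auto simp: card_1_singleton_iff)
  then show ?case
    by (intro exI [of _ "\<lambda>_. F [a]"]) (simp add: index_set_0)
next
  case (Suc n)
  let ?S = "\<lambda>c xs. \<Sum>I\<in>index_set n. c I * flag_monomial z I xs"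
  have "\<exists>c. \<forall>xs\<in>permutations_of_set (A - {a}). F (a # xs) = ?S c xs" if a: "a \<in> A" for a
  proof (rule Suc.IH)
    fix xs b c assume "xs \<in> permutations_of_set (A - {a})" "b \<in> A - {a}" "c \<in> A - {a}"
    then show "z b - z c dvd F (a # xs) - F (a # map (transpose b c) xs)"
      using Suc.prems(2) [of "a # xs" b c] a by (auto simp: permutations_of_set_Cons_iff)
  qed (use Suc.prems(1) a in auto)
  then obtain g where g: "\<And>a xs. a \<in> A \<Longrightarrow> xs \<in> permutations_of_set (A - {a}) \<Longrightarrow>
      F (a # xs) = ?S (g a) xs"
    by metis
  have congr: "z a - z b dvd g a I - g b I"
    if ab: "a \<in> A" "b \<in> A" and I: "I \<in> index_set n" for a b I
  proof (cases "a = b")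
    case False
    let ?t = "transpose a b"
    show ?thesis
    proof (rule flag_monomials_independent_mod [where A = "A - {a}" and z = z and n = n
          and h = "\<lambda>I. g a I - g b I"])
      fix xs assume xs: "xs \<in> permutations_of_set (A - {a})"
      \<comment> \<open>The exchange turns \<open>a # xs\<close> into \<open>b # map ?t xs\<close>,
        whose tail is expanded by \<open>g b\<close>. Modulo \<open>z a - z b\<close> the monomials
        at \<open>map ?t xs\<close> may be replaced by those at \<open>xs\<close>, which makes the
        two expansions comparable.\<close>
      have "?t ` (A - {a}) = A - {b}"
        using ab False by (subst image_set_diff) (auto simp: transpose_image_eq)
      then have "map ?t xs \<in> permutations_of_set (A - {b})"
        using xs by (auto simp: permutations_of_set_def distinct_map inj_on_subset [OF inj_transpose])
      then have "F (b # map ?t xs) = ?S (g b) (map ?t xs)"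
        using g ab by blast
      moreover have "z a - z b dvd F (a # xs) - F (b # map ?t xs)"
        using Suc.prems(2) [of "a # xs" a b] ab xs by (simp add: permutations_of_set_Cons_iff)
      moreover have "z a - z b dvd ?S (g b) xs - ?S (g b) (map ?t xs)"
      proof -
        have "?S (g b) xs - ?S (g b) (map ?t xs) =
            (\<Sum>I\<in>index_set n. g b I * (flag_monomial z I xs - flag_monomial z I (map ?t xs)))"
          by (simp only: sum_subtractf right_diff_distrib)
        then show ?thesis
          by (simp only:) (intro dvd_sum dvd_mult flag_monomial_map_transpose)
      qed
      ultimately have "z a - z b dvd (?S (g a) xs - ?S (g b) (map ?t xs))
          - (?S (g b) xs - ?S (g b) (map ?t xs))"
        using g [OF ab(1) xs] by (metis dvd_diff)
      then have "z a - z b dvd ?S (g a) xs - ?S (g b) xs"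
        by (simp only: diff_diff_eq2 diff_add_cancel)
      then show "z a - z b dvd ?S (\<lambda>I. g a I - g b I) xs"
        by (simp add: left_diff_distrib sum_subtractf)
    next
      \<comment> \<open>Removing \<open>a\<close> excludes the pair \<open>{a, b}\<close>, so the
        remaining variables stay distinct modulo \<open>z a - z b\<close>.\<close>
      fix c e assume "c \<in> A - {a}" "e \<in> A - {a}" "z a - z b dvd z c - z e"
      then show "c = e"
        using dvd_difference [OF False, of c e] by (auto simp: doubleton_eq_iff)
    qed (use prime [OF False] Suc.prems(1) ab I in auto)
  qed simp
  have "finite A" "A \<noteq> {}"
    using Suc.prems(1) by (auto intro: card_ge_0_finite)
  then have "\<forall>I\<in>index_set n. \<exists>p. Polynomial.degree p < card A \<and> (\<forall>a\<in>A. poly p (z a) = g a I)"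
    using congr by (intro ballI interpolation) auto
  then obtain p where p: "\<And>I. I \<in> index_set n \<Longrightarrow> Polynomial.degree (p I) < card A"
    "\<And>I a. I \<in> index_set n \<Longrightarrow> a \<in> A \<Longrightarrow> poly (p I) (z a) = g a I"
    by metis
  \<comment> \<open>The tail of the index selects an interpolating polynomial, its head the
    coefficient.\<close>
  define c where "c I = Polynomial.coeff (p (tl I)) (nat (List.hd I))" for I
  have "F xs = (\<Sum>I\<in>index_set (Suc n). c I * flag_monomial z I xs)"
    if xs: "xs \<in> permutations_of_set A" for xs
  proof -
    obtain a ys where ays: "xs = a # ys"
      using xs \<open>A \<noteq> {}\<close> by (cases xs) (auto simp: permutations_of_set_def)
    then have a: "a \<in> A" "ys \<in> permutations_of_set (A - {a})"
      using xs by (simp_all add: permutations_of_set_Cons_iff)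
    have "(\<Sum>i\<le>Suc n. c (int i # I) * z a ^ i) = g a I" if "I \<in> index_set n" for I
      using p(1) [OF that] p(2) [OF that a(1)] Suc.prems(1)
      by (simp add: c_def poly_eq_sum_atMost [of "p I" "Suc n"] del: sum.atMost_Suc)
    then show ?thesis
      using g [OF a] by (simp only: ays sum_index_set_Suc) simp
  qed
  then show ?case
    by blast
qed

section \<open>Congruences of Laurent polynomials\<close>

lemma act_eq_self:
  assumes "\<And>i. i \<in> {1..n+1} \<Longrightarrow> \<sigma> i = i" "p \<in> carrier (rep_ring n)"
  shows "act \<sigma> p = p"
proof -
  have "frag_extend (wt \<circ> \<sigma>) \<chi> = \<chi>" if "\<chi> \<in> weight_lattice n" for \<chi>
    using that assms(1) frag_extend_eq [of \<chi> "wt \<circ> \<sigma>" wt] frag_expansion [of \<chi>]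
    by (auto simp: weight_lattice_def subset_iff)
  then show ?thesis
    using assms(2) frag_extend_eq [of p "expw \<circ> frag_extend (wt \<circ> \<sigma>)" expw] frag_expansion [of p]
    by (auto simp: act_def rep_ring_def subset_iff)
qed

text \<open>The substitution \<open>z\<^sub>i \<mapsto> z\<^sub>1\<close> for \<open>i \<notin> {1..n+1}\<close>, a ring retraction of \<^typ>\<open>laurent\<close> onto
  \<open>rep_ring n\<close>.\<close>

definition rep_retract :: "nat \<Rightarrow> laurent \<Rightarrow> laurent" where
  "rep_retract n = act (\<lambda>i. if i \<in> {1..n+1} then i else 1)"

lemma rep_retract_carrier: "rep_retract n p \<in> carrier (rep_ring n)"
proof -
  let ?\<rho> = "\<lambda>i. if i \<in> {1..n+1} then i else 1"
  have "frag_extend (wt \<circ> ?\<rho>) \<chi> \<in> weight_lattice n" for \<chi>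
    using keys_frag_extend [of "wt \<circ> ?\<rho>" \<chi>]
    by (force simp: weight_lattice_def split: if_splits)
  then show ?thesis
    using keys_frag_extend [of "expw \<circ> frag_extend (wt \<circ> ?\<rho>)" p]
    by (auto simp: rep_retract_def act_def rep_ring_def subset_iff)
qed

text \<open>Moves identities found in the full type \<open>laurent\<close> into
  \<open>rep_ring n\<close>: applying the retraction to both sides fixes the known elements and
  replaces the unknown ones by elements of the carrier.\<close>

lemma rep_retract_eq_self: "p \<in> carrier (rep_ring n) \<Longrightarrow> rep_retract n p = p"
  unfolding rep_retract_def by (rule act_eq_self) auto

lemma rep_retract_mult: "rep_retract n (p * q) = rep_retract n p * rep_retract n q"
  by (simp add: rep_retract_def act_mult)

lemma rep_retract_sum: "rep_retract n (\<Sum>i\<in>A. h i) = (\<Sum>i\<in>A. rep_retract n (h i))"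
proof (induction A rule: infinite_finite_induct)
  case (insert i A)
  then show ?case
    by (simp add: rep_retract_def act_add)
qed (simp_all add: rep_retract_def act_def)

lemma zvar_carrier: "i \<in> {1..n+1} \<Longrightarrow> zvar i \<in> carrier (rep_ring n)"
  by (auto simp: zvar_def rep_ring_def weight_lattice_def)

lemma mult_carrier:
  "p \<in> carrier (rep_ring n) \<Longrightarrow> q \<in> carrier (rep_ring n) \<Longrightarrow> p * q \<in> carrier (rep_ring n)"
  using monoid.m_closed [OF cring.axioms(1) [OF cring_rep_ring, THEN ring.is_monoid], of p n q]
  by simp

lemma uminus_carrier: "p \<in> carrier (rep_ring n) \<Longrightarrow> - p \<in> carrier (rep_ring n)"
  by (simp add: rep_ring_def)

lemma diff_carrier:
  "p \<in> carrier (rep_ring n) \<Longrightarrow> q \<in> carrier (rep_ring n) \<Longrightarrow> p - q \<in> carrier (rep_ring n)"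
  using keys_diff [of p q] by (auto simp: rep_ring_def)

lemma one_carrier: "1 \<in> carrier (rep_ring n)"
  by (auto simp: rep_ring_def weight_lattice_def)

lemma flag_monomial_carrier:
  "set xs \<subseteq> {1..n+1} \<Longrightarrow> flag_monomial zvar I xs \<in> carrier (rep_ring n)"
proof (induction I arbitrary: xs)
  case (Cons i I)
  have pow: "zvar x ^ k \<in> carrier (rep_ring n)" if "x \<in> {1..n+1}" for x k
    using that by (induction k)
      (simp_all only: power_0 power_Suc one_carrier mult_carrier zvar_carrier)
  show ?case
  proof (cases xs)
    case (Cons x ys)
    then show ?thesis
      using Cons.IH [of ys] Cons.prems pow [of x] by (auto intro!: mult_carrier)
  qed (simp add: flag_monomial_def one_carrier)
qed (simp add: one_carrier)

section \<open>Divisibility by differences of variables\<close>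

lemma zvar_eq_iff: "zvar i = zvar j \<longleftrightarrow> i = j"
  by (simp add: zvar_def frag_of_eq)

text \<open>Since \<open>u - v\<close> equals \<open>(y - x) * u * v\<close>, congruences pass to
  inverses, as negative exponents demand.\<close>

lemma dvd_diff_inverses:
  fixes d :: "'a::comm_ring_1"
  assumes "d dvd x - y" "x * u = 1" "y * v = 1"
  shows "d dvd u - v"
proof -
  have "u - v = (y * v) * u - (x * u) * v"
    by (simp add: assms)
  also have "\<dots> = (x - y) * (- u * v)"
    by (simp add: algebra_simps)
  finally show ?thesis
    using assms(1) by simp
qed

text \<open>The substitution \<open>z_b\<close> to \<open>z_a\<close> is trivial modulo
  \<open>z_a - z_b\<close> on variables. One induction over weights extends this to monomials,
  differences of weights being quotients; a second, over Laurent polynomials, extends it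
  linearly.\<close>

lemma zvar_diff_dvd_diff_act: "zvar a - zvar b dvd p - act (id(b := a)) p"
proof -
  define e where "e = frag_extend (wt \<circ> id(b := a))"
  let ?d = "zvar a - zvar b"
  have e_diff: "e (\<chi> - \<psi>) = e \<chi> - e \<psi>" for \<chi> \<psi>
    by (simp add: e_def frag_extend_diff)
  have monomial: "?d dvd expw \<chi> - expw (e \<chi>)" for \<chi>
  proof (induction \<chi> rule: frag_induction [OF subset_UNIV])
    case 1
    then show ?case
      by (simp add: e_def)
  next
    case (2 i)
    have "?d dvd zvar b - zvar a"
      using dvd_minus_iff [of ?d ?d] by simp
    then show ?case
      by (simp add: e_def flip: zvar_def)
  next
    case (3 \<chi> \<psi>)
    let ?u = "expw (- \<psi>)" and ?v = "expw (- e \<psi>)"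
    have inverse: "?d dvd ?u - ?v"
      using 3(2) by (rule dvd_diff_inverses) (simp_all flip: expw_add)
    have "expw (\<chi> - \<psi>) - expw (e (\<chi> - \<psi>)) = expw \<chi> * ?u - expw (e \<chi>) * ?v"
      by (simp add: e_diff flip: expw_add)
    also have "\<dots> = (expw \<chi> - expw (e \<chi>)) * ?u + expw (e \<chi>) * (?u - ?v)"
      by (simp only: left_diff_distrib right_diff_distrib diff_add_cancel add_diff_eq)
    finally show ?case
      using 3(1) inverse by (simp only: dvd_add dvd_mult dvd_mult2)
  qed
  show ?thesis
  proof (induction p rule: frag_induction [OF subset_UNIV])
    case (2 \<chi>)
    then show ?case
      using monomial [of \<chi>] by (simp only: act_expw e_def)
  next
    case (3 p q)
    have "p - q - act (id(b := a)) (p - q) =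
        (p - act (id(b := a)) p) - (q - act (id(b := a)) q)"
      by (simp add: act_diff)
    then show ?case
      using 3 by (simp only: dvd_diff)
  qed (simp add: act_def)
qed

text \<open>The kernel of the substitution is generated by the difference: the substitution kills
  it, and changes every \<open>p\<close> only by a multiple of it.\<close>

lemma zvar_diff_dvd_iff: "zvar a - zvar b dvd p \<longleftrightarrow> act (id(b := a)) p = 0"
proof
  assume "zvar a - zvar b dvd p"
  then show "act (id(b := a)) p = 0"
    by (auto simp: act_mult act_diff act_z elim!: dvdE)
next
  assume "act (id(b := a)) p = 0"
  then show "zvar a - zvar b dvd p"
    using zvar_diff_dvd_diff_act [of a b p] by simp
qed

text \<open>The kernel of a ring homomorphism into an integral domain satisfies the primality
  condition, and the substitution identifies distinct variables only when they are
  \<open>z_a\<close> and \<open>z_b\<close>.\<close>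

lemma prime_differences_zvar: "prime_differences zvar"
proof
  fix a b c e :: nat assume "a \<noteq> b" "zvar a - zvar b dvd zvar c - zvar e"
  then show "c = e \<or> {c, e} = {a, b}"
    by (auto simp: zvar_diff_dvd_iff act_diff act_z zvar_eq_iff split: if_splits)
qed (simp add: zvar_diff_dvd_iff act_mult)

text \<open>The generator and \<open>zvar a - zvar b\<close> differ by the unit
  \<open>- zvar b\<close>. The ideal requires a cofactor in \<open>rep_ring n\<close>, which the
  retraction supplies.\<close>

lemma PIdl_iff_dvd:
  assumes "p \<in> carrier (rep_ring n)" "a \<in> {1..n+1}" "b \<in> {1..n+1}"
  shows "p \<in> PIdl\<^bsub>rep_ring n\<^esub> (1 - expw (wt a - wt b)) \<longleftrightarrow> zvar a - zvar b dvd p"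
proof
  assume "p \<in> PIdl\<^bsub>rep_ring n\<^esub> (1 - expw (wt a - wt b))"
  then obtain r where "p = r * (1 - expw (wt a - wt b))"
    by (auto simp: cgenideal_def)
  moreover have "1 - expw (wt a - wt b) = (zvar a - zvar b) * - expw (- wt b)"
    by (simp add: zvar_def algebra_simps flip: expw_add)
  ultimately show "zvar a - zvar b dvd p"
    by simp
next
  assume "zvar a - zvar b dvd p"
  then obtain k where "p = (zvar a - zvar b) * k"
    by (elim dvdE)
  then have "rep_retract n p = rep_retract n (zvar a - zvar b) * rep_retract n k"
    by (simp only: rep_retract_mult)
  then have "p = (zvar a - zvar b) * rep_retract n k"
    using assms by (simp only: rep_retract_eq_self diff_carrier zvar_carrier)
  moreover have "zvar b * expw (wt a - wt b) = zvar a"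
    by (simp add: zvar_def flip: expw_add)
  then have "zvar a - zvar b = - zvar b * (1 - expw (wt a - wt b))"
    by (simp add: right_diff_distrib)
  ultimately have "p = - zvar b * rep_retract n k * (1 - expw (wt a - wt b))"
    by (simp add: mult_ac)
  moreover have "- zvar b * rep_retract n k \<in> carrier (rep_ring n)"
    using assms by (intro mult_carrier uminus_carrier zvar_carrier rep_retract_carrier)
  ultimately show "p \<in> PIdl\<^bsub>rep_ring n\<^esub> (1 - expw (wt a - wt b))"
    unfolding cgenideal_def rep_ring_simps by blast
qed

section \<open>Classes on the flag graph\<close>

lemma transpose_comp_vertex:
  assumes "\<sigma> \<in> vertices n" "a \<in> {1..n+1}" "b \<in> {1..n+1}"
  shows "transpose a b \<circ> \<sigma> \<in> vertices n"
  using assms by (auto simp: vertices_def intro!: permutes_compose permutes_swap_id)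

text \<open>Exchanging the positions \<open>i\<close> and \<open>j\<close> equals exchanging the
  values \<open>\<sigma> i\<close> and \<open>\<sigma> j\<close>, the two values in the axial
  weight. The condition thus concerns lists of values, and symmetry removes the order
  \<open>i < j\<close>.\<close>

lemma K_alg_carrier_iff:
  "f \<in> carrier (K_alg n) \<longleftrightarrow> f \<in> vertices n \<rightarrow>\<^sub>E carrier (rep_ring n) \<and>
    (\<forall>\<sigma>\<in>vertices n. \<forall>a\<in>{1..n+1}. \<forall>b\<in>{1..n+1}.
      zvar a - zvar b dvd f \<sigma> - f (transpose a b \<circ> \<sigma>))"
proof (cases "f \<in> vertices n \<rightarrow>\<^sub>E carrier (rep_ring n)")
  case f: True
  have edge: "f \<sigma> - f (\<sigma> \<circ> transpose i j) \<in>
      PIdl\<^bsub>rep_ring n\<^esub> (1 - expw (axial \<sigma> (\<sigma> \<circ> transpose i j))) \<longleftrightarrow>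
      zvar (\<sigma> i) - zvar (\<sigma> j) dvd f \<sigma> - f (transpose (\<sigma> i) (\<sigma> j) \<circ> \<sigma>)"
    if "\<sigma> \<in> vertices n" "1 \<le> i" "i < j" "j \<le> n + 1" for \<sigma> i j
  proof -
    have \<sigma>: "\<sigma> permutes {1..n+1}"
      using that by (simp add: vertices_def)
    have mem: "\<sigma> i \<in> {1..n+1}" "\<sigma> j \<in> {1..n+1}"
      using permutes_in_image [OF \<sigma>] that by auto
    have "\<sigma> \<circ> transpose i j = transpose (\<sigma> i) (\<sigma> j) \<circ> \<sigma>"
      using permutes_inj [OF \<sigma>] by (auto simp: transpose_def inj_eq)
    moreover have "f \<sigma> - f (transpose (\<sigma> i) (\<sigma> j) \<circ> \<sigma>) \<in> carrier (rep_ring n)"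
      using f that(1) transpose_comp_vertex [OF that(1) mem] by (auto intro!: diff_carrier)
    ultimately show ?thesis
      using PIdl_iff_dvd mem axial_transpose [OF that(1,3)] by simp
  qed
  have "(\<forall>(\<sigma>, \<tau>)\<in>edges n. f \<sigma> - f \<tau> \<in> PIdl\<^bsub>rep_ring n\<^esub> (1 - expw (axial \<sigma> \<tau>))) \<longleftrightarrow>
    (\<forall>\<sigma>\<in>vertices n. \<forall>i j. 1 \<le> i \<longrightarrow> i < j \<longrightarrow> j \<le> n + 1 \<longrightarrow>
      zvar (\<sigma> i) - zvar (\<sigma> j) dvd f \<sigma> - f (transpose (\<sigma> i) (\<sigma> j) \<circ> \<sigma>))"
    (is "_ \<longleftrightarrow> ?P")
    using edge by (fastforce simp: edges_def)
  also have "?P \<longleftrightarrow> (\<forall>\<sigma>\<in>vertices n. \<forall>a\<in>{1..n+1}. \<forall>b\<in>{1..n+1}.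
      zvar a - zvar b dvd f \<sigma> - f (transpose a b \<circ> \<sigma>))" (is "_ \<longleftrightarrow> ?Q")
  proof
    assume P: ?P
    have "zvar a - zvar b dvd f \<sigma> - f (transpose a b \<circ> \<sigma>)"
      if \<sigma>: "\<sigma> \<in> vertices n" and ab: "a \<in> {1..n+1}" "b \<in> {1..n+1}" for \<sigma> a b
    proof -
      obtain i j where ij: "\<sigma> i = a" "\<sigma> j = b" "i \<in> {1..n+1}" "j \<in> {1..n+1}"
      proof -
        have "\<sigma> ` {1..n+1} = {1..n+1}"
          using \<sigma> by (simp only: vertices_def mem_Collect_eq permutes_image)
        then have "a \<in> \<sigma> ` {1..n+1}" "b \<in> \<sigma> ` {1..n+1}"
          using ab by simp_all
        then show thesis
          using that by blast
      qed
      consider "i < j" | "i = j" | "j < i"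
        by linarith
      then show ?thesis
      proof cases
        case 1
        then show ?thesis
          using P \<sigma> ij by auto
      next
        case 2
        then show ?thesis
          using ij by simp
      next
        case 3
        then have "zvar b - zvar a dvd f \<sigma> - f (transpose b a \<circ> \<sigma>)"
          using P \<sigma> ij by auto
        then show ?thesis
          using minus_dvd_iff [of "zvar a - zvar b"] by (simp add: transpose_commute)
      qed
    qed
    then show ?Q
      by blast
  next
    assume Q: ?Q
    have "\<sigma> i \<in> {1..n+1}" if "\<sigma> \<in> vertices n" "i \<in> {1..n+1}" for \<sigma> i
      using that permutes_in_image [of \<sigma> "{1..n+1}" i] by (simp add: vertices_def)
    then show ?P
      using Q by auto
  qed
  finally show ?thesis
    using f by (simp add: K_alg_def)
qed (simp add: K_alg_def)

text \<open>One-line notation; the half-open bound \<open>n + 2\<close> includes position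
  \<open>n + 1\<close>.\<close>

definition flag_of :: "nat \<Rightarrow> (nat \<Rightarrow> nat) \<Rightarrow> nat list" where
  "flag_of n \<sigma> = map \<sigma> [1..<n+2]"

lemma flag_of_transpose_comp: "flag_of n (transpose a b \<circ> \<sigma>) = map (transpose a b) (flag_of n \<sigma>)"
  by (simp add: flag_of_def)

text \<open>Injective because permutations fix everything outside \<open>{1..n+1}\<close>;
  surjective by counting, both sides having \<open>(n + 1)!\<close> elements.\<close>

lemma bij_betw_flag_of: "bij_betw (flag_of n) (vertices n) (permutations_of_set {1..n+1})"
proof -
  have upt: "set [1..<n+2] = {1..n+1}"
    by auto
  have inj: "inj_on (flag_of n) (vertices n)"
  proof (rule inj_onI)
    fix \<sigma> \<tau> assume "\<sigma> \<in> vertices n" "\<tau> \<in> vertices n" "flag_of n \<sigma> = flag_of n \<tau>"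
    then have perm: "\<sigma> permutes {1..n+1}" "\<tau> permutes {1..n+1}"
      and eq: "\<forall>i\<in>{1..n+1}. \<sigma> i = \<tau> i"
      unfolding flag_of_def vertices_def map_eq_conv upt by auto
    show "\<sigma> = \<tau>"
    proof
      show "\<sigma> i = \<tau> i" for i
        using eq permutes_not_in [OF perm(1), of i] permutes_not_in [OF perm(2), of i]
        by (cases "i \<in> {1..n+1}") simp_all
    qed
  qed
  have "flag_of n \<sigma> \<in> permutations_of_set {1..n+1}" if "\<sigma> \<in> vertices n" for \<sigma>
  proof -
    have \<sigma>: "\<sigma> permutes {1..n+1}"
      using that by (simp add: vertices_def)
    then show ?thesis
      unfolding flag_of_def
      by (intro permutations_of_setI)
        (simp_all only: set_map upt permutes_image distinct_map distinct_upt permutes_inj_on)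
  qed
  moreover have "card (vertices n) = card (permutations_of_set {1..n+1})"
    unfolding vertices_def by (subst card_permutations [where n = "n + 1"]) simp_all
  ultimately have "flag_of n ` vertices n = permutations_of_set {1..n+1}"
    using inj by (intro card_subset_eq) (auto simp: card_image)
  then show ?thesis
    using inj by (simp add: bij_betw_def)
qed

text \<open>\<open>act \<sigma>\<close> respects products and sends \<open>zvar k\<close> to
  \<open>zvar (\<sigma> k)\<close>; it remains to shift to list positions counted from zero.\<close>

lemma C_class_eq_flag_monomial:
  assumes "I \<in> index_set n" "\<sigma> \<in> vertices n"
  shows "C_class n I \<sigma> = flag_monomial zvar I (flag_of n \<sigma>)"
proof -
  have act_prod: "act \<sigma> (\<Prod>k\<in>A. h k) = (\<Prod>k\<in>A. act \<sigma> (h k))" for A :: "nat set" and h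
    by (induction A rule: infinite_finite_induct) (simp_all add: act_one act_mult)
  have act_power: "act \<sigma> (p ^ k) = act \<sigma> p ^ k" for p k
    by (induction k) (simp_all add: act_one act_mult)
  have "C_class n I \<sigma> = (\<Prod>k=1..n. zvar (\<sigma> k) ^ nat (I ! (k - 1)))"
    using assms(2) by (simp add: C_class_def act_prod act_power act_z)
  also have "\<dots> = (\<Prod>k<n. zvar (\<sigma> (Suc k)) ^ nat (I ! k))"
    by (rule prod.reindex_bij_witness [of _ Suc "\<lambda>k. k - 1"]) auto
  also have "\<dots> = flag_monomial zvar I (flag_of n \<sigma>)"
    unfolding flag_monomial_def prod.list_conv_set_nth flag_of_def
    using assms(1) by (auto simp: index_set_def atLeast0LessThan simp del: upt_Suc intro!: prod.cong)
  finally show ?thesis .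
qed

lemma C_class_carrier:
  assumes "I \<in> index_set n"
  shows "C_class n I \<in> carrier (K_alg n)"
  unfolding K_alg_carrier_iff
proof (intro conjI ballI)
  have "set (flag_of n \<sigma>) = {1..n+1}" if "\<sigma> \<in> vertices n" for \<sigma>
    using bij_betwE [OF bij_betw_flag_of] that by (auto dest: permutations_of_setD)
  then show "C_class n I \<in> vertices n \<rightarrow>\<^sub>E carrier (rep_ring n)"
    using flag_monomial_carrier C_class_eq_flag_monomial [OF assms]
    by (auto simp: PiE_iff) (simp add: C_class_def)
  fix \<sigma> a b assume "\<sigma> \<in> vertices n" "a \<in> {1..n+1}" "b \<in> {1..n+1}"
  then show "zvar a - zvar b dvd C_class n I \<sigma> - C_class n I (transpose a b \<circ> \<sigma>)"
    using flag_monomial_map_transpose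
    by (simp add: C_class_eq_flag_monomial [OF assms] transpose_comp_vertex flag_of_transpose_comp)
qed

lemma invariant_C_class:
  assumes "I \<in> index_set n"
  shows "invariant_class n (C_class n I)"
  unfolding invariant_class_def
proof (intro conjI ballI C_class_carrier assms)
  have id: "id \<in> vertices n"
    by (simp add: vertices_def permutes_id)
  fix u assume u: "u \<in> vertices n"
  have "act id p = p" for p
    by (simp add: act_def o_def flip: frag_expansion)
  then show "C_class n I u = act u (C_class n I id)"
    using id u by (simp add: C_class_def)
qed

section \<open>Linear independence and spanning\<close>

lemma finsum_K_alg_apply:
  assumes "finite F" "F \<subseteq> carrier (K_alg n)" "c \<in> F \<rightarrow> carrier (rep_ring n)" "\<sigma> \<in> vertices n"
  shows "(\<Oplus>\<^bsub>K_alg n\<^esub>b\<in>F. c b \<odot>\<^bsub>K_alg n\<^esub> b) \<sigma> = (\<Sum>b\<in>F. c b * b \<sigma>)"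
proof -
  interpret K: algebra "rep_ring n" "K_alg n"
    by (rule algebra_K_alg)
  have ops: "\<zero>\<^bsub>K_alg n\<^esub> \<sigma> = 0" "(f \<oplus>\<^bsub>K_alg n\<^esub> g) \<sigma> = f \<sigma> + g \<sigma>" "(r \<odot>\<^bsub>K_alg n\<^esub> f) \<sigma> = r * f \<sigma>" for f g r
    using assms(4) by (simp_all add: K_alg_def)
  show ?thesis
    using assms(1-3)
  proof (induction F rule: finite_induct)
    case (insert b F)
    have "(\<lambda>b. c b \<odot>\<^bsub>K_alg n\<^esub> b) \<in> F \<rightarrow> carrier (K_alg n)" "c b \<odot>\<^bsub>K_alg n\<^esub> b \<in> carrier (K_alg n)"
      using insert.prems by (auto intro!: K.smult_closed)
    then show ?case
      using insert by (simp add: K.M.finsum_insert ops)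
  qed (simp add: ops)
qed

text \<open>The case \<open>d = 0\<close> of independence: zero satisfies the primality condition in
  an integral domain, and distinct variables are incongruent modulo zero.\<close>

lemma C_classes_independent:
  assumes "\<And>\<sigma>. \<sigma> \<in> vertices n \<Longrightarrow> (\<Sum>I\<in>index_set n. h I * C_class n I \<sigma>) = 0"
    and "I \<in> index_set n"
  shows "h I = 0"
proof -
  have "0 dvd h I"
  proof (rule flag_monomials_independent_mod [where A = "{1..n+1}" and z = zvar and n = n])
    fix xs assume "xs \<in> permutations_of_set {1..n+1}"
    then obtain \<sigma> where "\<sigma> \<in> vertices n" "xs = flag_of n \<sigma>"
      using bij_betw_imp_surj_on [OF bij_betw_flag_of] by blast
    then have "(\<Sum>I\<in>index_set n. h I * flag_monomial zvar I xs) = 0"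
      using assms(1) [of \<sigma>] by (simp add: C_class_eq_flag_monomial cong: sum.cong)
    then show "0 dvd (\<Sum>I\<in>index_set n. h I * flag_monomial zvar I xs)"
      by simp
  qed (use assms(2) in \<open>auto simp: zvar_eq_iff\<close>)
  then show ?thesis
    by simp
qed

lemma C_classes_span:
  assumes f: "f \<in> carrier (K_alg n)"
  obtains c where "\<And>I. c I \<in> carrier (rep_ring n)"
    and "\<And>\<sigma>. \<sigma> \<in> vertices n \<Longrightarrow> f \<sigma> = (\<Sum>I\<in>index_set n. c I * C_class n I \<sigma>)"
proof -
  interpret prime_differences zvar
    by (rule prime_differences_zvar)
  \<comment> \<open>\<open>F\<close> transports \<open>f\<close> to lists along the bijection
    \<open>flag_of n\<close>.\<close>
  define F where "F xs = f (the_inv_into (vertices n) (flag_of n) xs)" for xs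
  have F: "F (flag_of n \<sigma>) = f \<sigma>" if "\<sigma> \<in> vertices n" for \<sigma>
    using that bij_betw_flag_of [of n] by (simp add: F_def the_inv_into_f_f bij_betw_def)
  have "\<exists>c. \<forall>xs\<in>permutations_of_set {1..n+1}.
      F xs = (\<Sum>I\<in>index_set n. c I * flag_monomial zvar I xs)"
  proof (rule flag_monomials_span)
    fix xs a b assume xs: "xs \<in> permutations_of_set {1..n+1}"
      and ab: "a \<in> {1..n+1}" "b \<in> {1..n+1}"
    obtain \<sigma> where "\<sigma> \<in> vertices n" "xs = flag_of n \<sigma>"
      using xs bij_betw_imp_surj_on [OF bij_betw_flag_of] by blast
    then show "zvar a - zvar b dvd F xs - F (map (transpose a b) xs)"
      using f ab F [OF transpose_comp_vertex, of \<sigma> a b]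
      by (simp add: F flag_of_transpose_comp K_alg_carrier_iff)
  qed simp
  then obtain c where c: "\<And>xs. xs \<in> permutations_of_set {1..n+1} \<Longrightarrow>
      F xs = (\<Sum>I\<in>index_set n. c I * flag_monomial zvar I xs)"
    by blast
  show thesis
  proof
    show "rep_retract n (c I) \<in> carrier (rep_ring n)" for I
      by (rule rep_retract_carrier)
    fix \<sigma> assume \<sigma>: "\<sigma> \<in> vertices n"
    have val: "g \<sigma> \<in> carrier (rep_ring n)" if "g \<in> carrier (K_alg n)" for g
      using that \<sigma> by (auto simp: K_alg_carrier_iff)
    have "f \<sigma> = (\<Sum>I\<in>index_set n. c I * C_class n I \<sigma>)"
      using c [of "flag_of n \<sigma>"] \<sigma> bij_betwE [OF bij_betw_flag_of]
      by (simp add: F C_class_eq_flag_monomial cong: sum.cong)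
    \<comment> \<open>The coefficients found so far may involve foreign variables; retracting both
      sides leaves \<open>f \<sigma>\<close> and the values of the classes unchanged.\<close>
    then have "f \<sigma> = (\<Sum>I\<in>index_set n. rep_retract n (c I) * rep_retract n (C_class n I \<sigma>))"
      using rep_retract_eq_self [OF val [OF f]] by (simp only: flip: rep_retract_mult rep_retract_sum)
    then show "f \<sigma> = (\<Sum>I\<in>index_set n. rep_retract n (c I) * C_class n I \<sigma>)"
      by (simp add: rep_retract_eq_self val C_class_carrier cong: sum.cong)
  qed
qed

text \<open>Equal classes for distinct indices would give a relation with coefficients
  \<open>1\<close> and \<open>-1\<close>. Injectivity is needed because a basis is a set of classes,
  while coefficients are indexed by \<open>I\<close>.\<close>

lemma inj_on_C_class: "inj_on (C_class n) (index_set n)"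
proof (rule inj_onI)
  fix I J assume IJ: "I \<in> index_set n" "J \<in> index_set n" "C_class n I = C_class n J"
  show "I = J"
  proof (rule ccontr)
    assume "I \<noteq> J"
    let ?h = "\<lambda>L. (if L = I then 1 else 0) - (if L = J then 1 else 0) :: laurent"
    have "?h I = 0"
      by (rule C_classes_independent [of n])
        (use IJ in \<open>simp_all add: left_diff_distrib sum_subtractf finite_index_set if_distribR
          if_distrib [of "\<lambda>x. x * _"] sum.delta cong: if_cong\<close>)
    then show False
      using \<open>I \<noteq> J\<close> by simp
  qed
qed

theorem theorem8p1:
  fixes n :: nat
  assumes "n \<ge> 1"
  shows "module_basis (rep_ring n) (K_alg n) {C_class n I | I. I \<in> index_set n} \<and>
    (\<forall>f \<in> {C_class n I | I. I \<in> index_set n}. invariant_class n f)"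
proof -
  interpret K: algebra "rep_ring n" "K_alg n"
    by (rule algebra_K_alg)
  let ?B = "C_class n ` index_set n"
  have B_carrier: "?B \<subseteq> carrier (K_alg n)"
    using C_class_carrier by blast
  have "\<exists>F c. finite F \<and> F \<subseteq> ?B \<and> c \<in> F \<rightarrow> carrier (rep_ring n) \<and>
      v = (\<Oplus>\<^bsub>K_alg n\<^esub>b\<in>F. c b \<odot>\<^bsub>K_alg n\<^esub> b)" if v: "v \<in> carrier (K_alg n)" for v
  proof -
    obtain c where c: "\<And>I. c I \<in> carrier (rep_ring n)"
      and sum: "\<And>\<sigma>. \<sigma> \<in> vertices n \<Longrightarrow> v \<sigma> = (\<Sum>I\<in>index_set n. c I * C_class n I \<sigma>)"
      using C_classes_span [OF v] by blast
    \<comment> \<open>Injectivity lets coefficients on indices be read as coefficients on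
      classes.\<close>
    define c' where "c' b = c (the_inv_into (index_set n) (C_class n) b)" for b
    have c': "c' \<in> ?B \<rightarrow> carrier (rep_ring n)"
      using c by (simp add: c'_def)
    have "(\<Oplus>\<^bsub>K_alg n\<^esub>b\<in>?B. c' b \<odot>\<^bsub>K_alg n\<^esub> b) \<in> carrier (K_alg n)"
      using c' B_carrier by (intro K.M.finsum_closed) (auto intro!: K.smult_closed)
    moreover have "v \<sigma> = (\<Oplus>\<^bsub>K_alg n\<^esub>b\<in>?B. c' b \<odot>\<^bsub>K_alg n\<^esub> b) \<sigma>" if "\<sigma> \<in> vertices n" for \<sigma>
      using that B_carrier c'
      by (subst finsum_K_alg_apply)
        (auto simp: finite_index_set sum sum.reindex [OF inj_on_C_class] c'_def
          the_inv_into_f_f [OF inj_on_C_class])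
    ultimately have "v = (\<Oplus>\<^bsub>K_alg n\<^esub>b\<in>?B. c' b \<odot>\<^bsub>K_alg n\<^esub> b)"
      using v by (intro extensionalityI [of _ "vertices n"]) (auto simp: K_alg_carrier_iff PiE_def)
    then show ?thesis
      using c' finite_index_set by (intro exI [of _ ?B] exI [of _ c'] conjI) simp_all
  qed
  moreover have "c b = 0"
    if F: "finite F" "F \<subseteq> ?B" "c \<in> F \<rightarrow> carrier (rep_ring n)" "b \<in> F"
      and zero: "(\<Oplus>\<^bsub>K_alg n\<^esub>b\<in>F. c b \<odot>\<^bsub>K_alg n\<^esub> b) = \<zero>\<^bsub>K_alg n\<^esub>" for F c b
  proof -
    \<comment> \<open>The relation over \<open>F\<close> is extended by zero coefficients to the
      whole family of classes.\<close>
    define h where "h I = (if C_class n I \<in> F then c (C_class n I) else 0)" for I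
    obtain I where I: "I \<in> index_set n" "b = C_class n I"
      using F(2,4) by blast
    have "(\<Sum>I\<in>index_set n. h I * C_class n I \<sigma>) = 0" if "\<sigma> \<in> vertices n" for \<sigma>
    proof -
      have "(\<Sum>I\<in>index_set n. h I * C_class n I \<sigma>) =
          (\<Sum>b\<in>?B. (if b \<in> F then c b else 0) * b \<sigma>)"
        by (simp add: sum.reindex [OF inj_on_C_class] h_def)
      also have "\<dots> = (\<Sum>b\<in>F. c b * b \<sigma>)"
        using F(2) finite_index_set by (intro sum.mono_neutral_cong_right) auto
      also have "\<dots> = \<zero>\<^bsub>K_alg n\<^esub> \<sigma>"
        using F B_carrier that by (subst finsum_K_alg_apply [symmetric]) (auto simp: zero)
      also have "\<dots> = 0"
        using that by (simp add: K_alg_def)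
      finally show ?thesis .
    qed
    then have "h I = 0"
      using I(1) by (rule C_classes_independent)
    then show ?thesis
      using F(4) I(2) by (simp add: h_def)
  qed
  ultimately have "module_basis (rep_ring n) (K_alg n) ?B"
    unfolding module_basis_def using B_carrier by auto
  moreover have "{C_class n I | I. I \<in> index_set n} = ?B"
    by blast
  ultimately show ?thesis
    using invariant_C_class by auto
qed

end
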